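(* Let $l_s(\xi)$, $s=1,2,3$, where $\xi=\sum_{s=1}^3\alpha_s x_s$, be a solution of Lamé's system (with Guichard condition), such that $l_s$ is not constant for all $s$ (i.e. none of $l_1,l_2,l_3$ is constant). Then there exist $c_1,c_2,c_3\in\mathbb{R}\setminus\{0\}$ such that $$l_{i,\xi}=c_i\,l_k l_j\quad\text{for } i,j,k \text{ distinct},$$ $$c_1-c_2+c_3=0,$$ $$\alpha_1^2c_2c_3+\alpha_2^2c_1c_3+\alpha_3^2c_1c_2=0.$$ Moreover, the functions $l_i(\xi)$ are given by $$l_{1,\xi}^2=c_2(c_2-c_1)\Big(l_1^2-\frac{\lambda}{c_2}\Big)\Big(l_1^2-\frac{\lambda}{c_2-c_1}\Big),$$ $$l_2^2=\frac{c_2}{c_1}\Big(l_1^2-\frac{\lambda}{c_2}\Big),\qquad l_3^2=\frac{c_2-c_1}{c_1}\Big(l_1^2-\frac{\lambda}{c_2-c_1}\Big),$$ where $\lambda\in\mathbb{R}$.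
   Context: Here $(\alpha_1,\alpha_2,\alpha_3)\in\mathbb{R}^3$ is a nonzero vector, and each $l_s$ is a smooth nowhere vanishing function of $\xi$ on an open interval, regarded as a function of $x=(x_1,x_2,x_3)$ on the corresponding open set of $\mathbb{R}^3$; $l_{i,\xi}$ denotes the derivative with respect to $\xi$. Put $\varepsilon_1=\varepsilon_3=1$, $\varepsilon_2=-1$ and $h_{ij}=l_{i,x_j}/l_j$ for $i\ne j$. The functions are a solution of Lamé's system (with Guichard condition) if for all distinct $i,j,k\in\{1,2,3\}$: $$\varepsilon_i l_i^2+\varepsilon_j l_j^2+\varepsilon_k l_k^2=0\quad(\text{Guichard condition } l_1^2-l_2^2+l_3^2=0),$$ $$\varepsilon_i l_{i,x_i}+\varepsilon_j h_{ji}l_j+\varepsilon_k h_{ki}l_k=0,\qquad h_{ij,x_k}-h_{ik}h_{kj}=0,$$ $$h_{ij,x_j}+h_{ji,x_i}+h_{ik}h_{jk}=0,\qquad \varepsilon_i h_{ij,x_i}+\varepsilon_j h_{ji,x_j}+\varepsilon_k h_{ki}h_{kj}=0.$$ *)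

theory Defs
  imports "HOL-Analysis.Analysis"
begin

text \<open>
  Used on open sets only, where \<^term>\<open>deriv\<close> is the ordinary one-variable derivative.
\<close>
definition smooth_real_on :: "real set \<Rightarrow> (real \<Rightarrow> real) \<Rightarrow> bool" where
  "smooth_real_on S f \<longleftrightarrow> (\<forall>n. (deriv ^^ n) f differentiable_on S)"

definition partial :: "3 \<Rightarrow> (real ^ 3 \<Rightarrow> real) \<Rightarrow> real ^ 3 \<Rightarrow> real" where
  "partial j f x = deriv (\<lambda>t. f (x + t *\<^sub>R axis j 1)) 0"

definition eps :: "3 \<Rightarrow> real" where
  "eps i = (if i = 2 then - 1 else 1)"

definition rot_coeff :: "(3 \<Rightarrow> real ^ 3 \<Rightarrow> real) \<Rightarrow> 3 \<Rightarrow> 3 \<Rightarrow> real ^ 3 \<Rightarrow> real" where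
  "rot_coeff L i j x = partial j (L i) x / L j x"

text \<open>
  Lame's system on the open set \<open>U\<close>. The first equation is Guichard's
  condition \<open>L\<^sub>1\<^sup>2 - L\<^sub>2\<^sup>2 + L\<^sub>3\<^sup>2 = 0\<close>.
\<close>
definition lame_guichard :: "(real ^ 3) set \<Rightarrow> (3 \<Rightarrow> real ^ 3 \<Rightarrow> real) \<Rightarrow> bool" where
  "lame_guichard U L \<longleftrightarrow>
    (let h = rot_coeff L in
     \<forall>x\<in>U. \<forall>i j k. i \<noteq> j \<and> j \<noteq> k \<and> i \<noteq> k \<longrightarrow>
       eps i * (L i x)\<^sup>2 + eps j * (L j x)\<^sup>2 + eps k * (L k x)\<^sup>2 = 0 \<and>
       eps i * partial i (L i) x + eps j * h j i x * L j x + eps k * h k i x * L k x = 0 \<and>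
       partial k (h i j) x - h i k x * h k j x = 0 \<and>
       partial j (h i j) x + partial i (h j i) x + h i k x * h j k x = 0 \<and>
       eps i * partial i (h i j) x + eps j * partial j (h j i) x + eps k * h k i x * h k j x = 0)"

end

theory Submission
  imports Defs
begin

text \<open>
  Along \<open>\<xi> = \<alpha> \<bullet> x\<close> Lame's system becomes a system of ordinary differential equations. If
  \<open>\<alpha>\<^sub>j \<alpha>\<^sub>k \<noteq> 0\<close>, the equation for \<open>h\<^sub>i\<^sub>j\<^sub>,\<^sub>k\<close> says that \<open>l\<^sub>i' / (l\<^sub>j l\<^sub>k)\<close> has zero derivative.
  If only \<open>\<alpha>\<^sub>k\<close> vanishes, this still applies to \<open>l\<^sub>k\<close>, and then the derivative of
  Guichard's condition and the equation for \<open>h\<^sub>i\<^sub>k\<^sub>,\<^sub>k + h\<^sub>k\<^sub>i\<^sub>,\<^sub>i\<close> are linear in \<open>l\<^sub>i l\<^sub>i'\<close> and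
  \<open>l\<^sub>j l\<^sub>j'\<close>; they are independent because \<open>l\<^sub>k' \<noteq> 0\<close>, and so express both as multiples
  of \<open>l\<^sub>1 l\<^sub>2 l\<^sub>3\<close>. If only \<open>\<alpha>\<^sub>i\<close> is nonzero, \<open>l\<^sub>j'\<close> and
  \<open>l\<^sub>k'\<close> are constant multiples of \<open>l\<^sub>i\<close> with product zero, so one of \<open>l\<^sub>j, l\<^sub>k\<close> is constant.
  The algebraic relations follow by substitution, and \<open>\<lambda>\<close> is the first integral
  \<open>c\<^sub>2 l\<^sub>1\<^sup>2 - c\<^sub>1 l\<^sub>2\<^sup>2\<close>.
\<close>

section \<open>Triples of distinct indices\<close>

lemma index_exhaust:
  fixes i j k m :: 3
  assumes "i \<noteq> j" "j \<noteq> k" "i \<noteq> k"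
  shows "m = i \<or> m = j \<or> m = k"
  using assms exhaust_3[of i] exhaust_3[of j] exhaust_3[of k] exhaust_3[of m] by auto

lemma other_two_indices:
  fixes i :: 3
  obtains j k where "i \<noteq> j" "j \<noteq> k" "i \<noteq> k"
proof -
  consider "i = 1" | "i = 2" | "i = 3"
    using exhaust_3[of i] by blast
  then show thesis
    by cases (use that[of 2 3] that[of 1 3] that[of 1 2] in simp_all)
qed

section \<open>The reduced system of ordinary differential equations\<close>

text \<open>Here \<open>d\<close> and \<open>e\<close> are the first and second derivatives of
  \<open>l\<close>. Along \<open>\<alpha> \<bullet> x\<close> the coefficient \<open>h i j\<close>
  becomes \<open>a j * (d i t / l j t)\<close>, and each further partial derivative in direction
  \<open>k\<close> contributes a factor \<open>a k\<close>; the quotients in \<open>mixed\<close>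
  and \<open>gauss\<close> are the derivatives of \<open>d i / l j\<close> written out.\<close>

locale lame_ode =
  fixes a :: "3 \<Rightarrow> real" and I :: "real set" and l d e :: "3 \<Rightarrow> real \<Rightarrow> real"
  assumes a_nonzero: "\<exists>i. a i \<noteq> 0"
    and open_I: "open I" and convex_I: "convex I" and I_nonempty: "I \<noteq> {}"
    and l_nonzero: "t \<in> I \<Longrightarrow> l i t \<noteq> 0"
    and l_deriv: "t \<in> I \<Longrightarrow> (l i has_real_derivative d i t) (at t)"
    and d_deriv: "t \<in> I \<Longrightarrow> (d i has_real_derivative e i t) (at t)"
    and not_constant: "\<exists>t\<in>I. d i t \<noteq> 0"
    and guichard: "\<lbrakk>t \<in> I; i \<noteq> j; j \<noteq> k; i \<noteq> k\<rbrakk> \<Longrightarrow>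
      eps i * (l i t)\<^sup>2 + eps j * (l j t)\<^sup>2 + eps k * (l k t)\<^sup>2 = 0"
    and mixed: "\<lbrakk>t \<in> I; i \<noteq> j; j \<noteq> k; i \<noteq> k\<rbrakk> \<Longrightarrow>
      a k * a j * ((e i t * l j t - d i t * d j t) / (l j t)\<^sup>2)
        = a k * a j * (d i t * d k t / (l k t * l j t))"
    and gauss: "\<lbrakk>t \<in> I; i \<noteq> j; j \<noteq> k; i \<noteq> k\<rbrakk> \<Longrightarrow>
      (a j)\<^sup>2 * ((e i t * l j t - d i t * d j t) / (l j t)\<^sup>2)
        + (a i)\<^sup>2 * ((e j t * l i t - d j t * d i t) / (l i t)\<^sup>2)
        + (a k)\<^sup>2 * (d i t * d j t / (l k t)\<^sup>2) = 0"
begin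

lemma eq_const_if_deriv_zero:
  assumes "\<And>t. t \<in> I \<Longrightarrow> (f has_real_derivative 0) (at t)"
  obtains c where "\<And>t. t \<in> I \<Longrightarrow> f t = c"
  using has_field_derivative_zero_constant[OF convex_I, of f] assms
  by (meson has_field_derivative_at_within)

lemma guichard_deriv:
  assumes t: "t \<in> I" and ne: "i \<noteq> j" "j \<noteq> k" "i \<noteq> k"
  shows "eps i * l i t * d i t + eps j * l j t * d j t + eps k * l k t * d k t = 0"
proof -
  let ?G = "\<lambda>t. eps i * (l i t)\<^sup>2 + eps j * (l j t)\<^sup>2 + eps k * (l k t)\<^sup>2"
  have "(?G has_real_derivative
      2 * (eps i * l i t * d i t + eps j * l j t * d j t + eps k * l k t * d k t)) (at t)"
    by (auto intro!: derivative_eq_intros l_deriv t simp: algebra_simps)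
  moreover have "(?G has_real_derivative 0) (at t)"
    by (rule has_field_derivative_transform_within_open[where f="\<lambda>_. 0" and S=I])
      (use open_I t guichard ne in auto)
  ultimately show ?thesis
    using DERIV_unique by fastforce
qed

section \<open>First-order equations, by the number of vanishing entries of \<open>a\<close>\<close>

lemma first_order_generic:
  assumes ne: "i \<noteq> j" "j \<noteq> k" "i \<noteq> k" and nz: "a j \<noteq> 0" "a k \<noteq> 0"
  obtains c where "\<And>t. t \<in> I \<Longrightarrow> d i t = c * l j t * l k t"
proof -
  have "((\<lambda>t. d i t / (l j t * l k t)) has_real_derivative 0) (at t)" if t: "t \<in> I" for t
  proof -
    note lz = l_nonzero[OF t]
    have eq: "(e i t * l j t - d i t * d j t) / (l j t)\<^sup>2 = d i t * d k t / (l k t * l j t)"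
      using mixed[OF t ne] nz by (metis mult_left_cancel no_zero_divisors)
    \<comment> \<open>This says that the numerator in the quotient rule for
      \<open>d i t / (l j t * l k t)\<close> vanishes.\<close>
    have "e i t * l j t * l k t - d i t * d j t * l k t = d i t * d k t * l j t"
      using eq lz[of j] lz[of k] by (simp add: divide_simps power2_eq_square) algebra
    then show ?thesis
      using lz by (auto intro!: derivative_eq_intros l_deriv d_deriv t simp: algebra_simps)
  qed
  then obtain c where "\<And>t. t \<in> I \<Longrightarrow> d i t / (l j t * l k t) = c"
    using eq_const_if_deriv_zero by blast
  then have "d i t = c * l j t * l k t" if "t \<in> I" for t
    using that l_nonzero by (force simp: field_simps)
  then show thesis by (rule that)
qed

lemma at_most_one_zero:
  assumes ne: "i \<noteq> j" "j \<noteq> k" "i \<noteq> k" and z: "a j = 0" "a k = 0"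
  shows False
proof -
  have ai: "a i \<noteq> 0"
    using a_nonzero index_exhaust[OF ne] z by metis
  \<comment> \<open>With \<open>a m = a n = 0\<close>, \<open>gauss\<close> for the pair
    \<open>i\<close>, \<open>m\<close> reduces to \<open>(a i)\<^sup>2\<close> times the derivative
    of \<open>d m / l i\<close>.\<close>
  have proportional: "\<exists>c. \<forall>t\<in>I. d m t = c * l i t" if m: "m \<noteq> i" "m \<noteq> n" "n \<noteq> i" "a m = 0" "a n = 0" for m n
  proof -
    have "((\<lambda>t. d m t / l i t) has_real_derivative 0) (at t)" if t: "t \<in> I" for t
    proof -
      have "(e m t * l i t - d m t * d i t) / (l i t)\<^sup>2 = 0"
        using gauss[OF t, of i m n] m ai by auto
      then show ?thesis
        using l_nonzero[OF t]
        by (auto intro!: derivative_eq_intros l_deriv d_deriv t simp: power2_eq_square)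
    qed
    then obtain c where "\<And>t. t \<in> I \<Longrightarrow> d m t / l i t = c"
      using eq_const_if_deriv_zero by blast
    then show ?thesis
      using l_nonzero by (metis nonzero_divide_eq_eq)
  qed
  obtain c where c: "\<forall>t\<in>I. d j t = c * l i t"
    using proportional[of j k] ne z by auto
  obtain c' where c': "\<forall>t\<in>I. d k t = c' * l i t"
    using proportional[of k j] ne z by auto
  obtain t where t: "t \<in> I"
    using I_nonempty by auto
  \<comment> \<open>For the pair \<open>j\<close>, \<open>k\<close> only the product term of
    \<open>gauss\<close> survives.\<close>
  have "d j t * d k t = 0"
    using gauss[OF t, of j k i] ne z ai l_nonzero[OF t] by auto
  then have "c = 0 \<or> c' = 0"
    using c c' t l_nonzero by auto
  then show False
    using c c' not_constant[of j] not_constant[of k] by auto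
qed

lemma first_order_one_zero:
  assumes ne: "i \<noteq> j" "j \<noteq> k" "i \<noteq> k" and z: "a k = 0"
  obtains c where "\<And>t. t \<in> I \<Longrightarrow> d i t = c * l j t * l k t"
proof -
  have ai: "a i \<noteq> 0" and aj: "a j \<noteq> 0"
    using at_most_one_zero[of j i k] at_most_one_zero[of i j k] ne z by auto
  obtain c where c: "\<And>t. t \<in> I \<Longrightarrow> d k t = c * l i t * l j t"
    using first_order_generic[of k i j] ne ai aj by metis
  have c0: "c \<noteq> 0"
    using c not_constant[of k] by auto
  \<comment> \<open>In \<open>gauss\<close> for the pair \<open>i\<close>, \<open>k\<close> the term
    with \<open>(a k)\<^sup>2\<close> drops out. Since \<open>d k / l i\<close> is
    \<open>c * l j\<close>, its derivative is \<open>c * d j\<close>; multiplying by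
    \<open>l j\<close> and cancelling \<open>c\<close> leaves this relation.\<close>
  have lin: "(a j)\<^sup>2 * (l i t * d i t) + (a i)\<^sup>2 * (l j t * d j t) = 0" if t: "t \<in> I" for t
  proof -
    note lz = l_nonzero[OF t]
    have "((\<lambda>t. c * l i t * l j t) has_real_derivative c * (d i t * l j t + l i t * d j t)) (at t)"
      by (auto intro!: derivative_eq_intros l_deriv t simp: algebra_simps)
    moreover have "((\<lambda>t. c * l i t * l j t) has_real_derivative e k t) (at t)"
      by (rule has_field_derivative_transform_within_open[OF d_deriv[OF t] open_I t]) (rule c)
    ultimately have ek: "e k t = c * (d i t * l j t + l i t * d j t)"
      using DERIV_unique by blast
    have "(e k t * l i t - d k t * d i t) / (l i t)\<^sup>2 = c * d j t"
      using lz[of i] unfolding ek c[OF t] by (simp add: field_simps power2_eq_square)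
    then have "(a i)\<^sup>2 * (c * d j t) + (a j)\<^sup>2 * (d i t * (c * l i t * l j t) / (l j t)\<^sup>2) = 0"
      using gauss[OF t, of i k j] ne z c[OF t] by simp
    then have "c * ((a j)\<^sup>2 * (l i t * d i t) + (a i)\<^sup>2 * (l j t * d j t)) = 0"
      using lz[of j] by (simp add: field_simps power2_eq_square)
    then show ?thesis using c0 by simp
  qed
  \<comment> \<open>The determinant of the linear system formed by \<open>guichard_deriv\<close> and
    \<open>lin\<close> in the unknowns \<open>l i * d i\<close> and \<open>l j * d j\<close>;
    \<open>solve\<close> is Cramer's rule for the first unknown, divided by
    \<open>l i\<close>.\<close>
  define D where "D = eps i * (a i)\<^sup>2 - eps j * (a j)\<^sup>2"
  have solve: "D * d i t = - eps k * c * (a i)\<^sup>2 * l j t * l k t" if t: "t \<in> I" for t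
  proof -
    have "l i t * (D * d i t) = l i t * (- eps k * c * (a i)\<^sup>2 * l j t * l k t)"
      using lin[OF t] guichard_deriv[OF t ne] unfolding c[OF t] D_def by algebra
    then show ?thesis using l_nonzero[OF t] mult_left_cancel by blast
  qed
  \<comment> \<open>Otherwise the right-hand side of \<open>solve\<close> would vanish, although all
    its factors are nonzero.\<close>
  have "D \<noteq> 0"
  proof
    assume "D = 0"
    moreover obtain t where "t \<in> I"
      using I_nonempty by auto
    ultimately show False
      using solve[of t] c0 ai l_nonzero by (auto simp: eps_def split: if_splits)
  qed
  then have "d i t = - eps k * c * (a i)\<^sup>2 / D * l j t * l k t" if "t \<in> I" for t
    using solve[OF that] by (simp add: field_simps)
  then show thesis by (rule that)
qed

lemma first_order:
  assumes ne: "i \<noteq> j" "j \<noteq> k" "i \<noteq> k"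
  shows "\<exists>c. \<forall>t\<in>I. d i t = c * l j t * l k t"
proof -
  consider "a j \<noteq> 0" "a k \<noteq> 0" | "a k = 0" | "a j = 0" by auto
  then show ?thesis
  proof cases
    case 1
    then show ?thesis using first_order_generic[OF ne] by metis
  next
    case 2
    then show ?thesis using first_order_one_zero[OF ne] by metis
  next
    case 3
    then obtain c where "\<And>t. t \<in> I \<Longrightarrow> d i t = c * l k t * l j t"
      using first_order_one_zero[of i k j] ne by metis
    then show ?thesis by (metis mult.assoc mult.commute)
  qed
qed

text \<open>The coefficient can be chosen to depend on \<open>i\<close> alone: the other two indices
  admit only two orderings, and the product of their functions is symmetric.\<close>

lemma first_order_coefficients:
  obtains c where "\<And>i j k t. \<lbrakk>i \<noteq> j; j \<noteq> k; i \<noteq> k; t \<in> I\<rbrakk> \<Longrightarrow> d i t = c i * l k t * l j t"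
proof -
  have "\<exists>c. \<forall>t\<in>I. \<forall>j k. i \<noteq> j \<and> j \<noteq> k \<and> i \<noteq> k \<longrightarrow> d i t = c * l k t * l j t" for i
  proof -
    obtain m n where mn: "i \<noteq> m" "m \<noteq> n" "i \<noteq> n"
      using other_two_indices .
    obtain c where c: "\<forall>t\<in>I. d i t = c * l m t * l n t"
      using first_order mn by blast
    have "d i t = c * l k t * l j t" if "t \<in> I" "i \<noteq> j" "j \<noteq> k" "i \<noteq> k" for t j k
    proof -
      have "j = m \<and> k = n \<or> j = n \<and> k = m"
        using index_exhaust[OF mn, of j] index_exhaust[OF mn, of k] that by auto
      then show ?thesis using c that(1) by auto
    qed
    then show ?thesis by blast
  qed
  then show thesis using that by metis
qed

section \<open>Algebraic relations between the coefficients, and the first integral\<close>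

context
  fixes c :: "3 \<Rightarrow> real"
  assumes c: "\<lbrakk>i \<noteq> j; j \<noteq> k; i \<noteq> k; t \<in> I\<rbrakk> \<Longrightarrow> d i t = c i * l k t * l j t"
begin

lemma coefficient_nonzero: "c i \<noteq> 0"
proof -
  obtain j k where "i \<noteq> j" "j \<noteq> k" "i \<noteq> k"
    using other_two_indices .
  then show ?thesis
    using c not_constant[of i] by fastforce
qed

text \<open>After substituting the first-order equations, the differentiated Guichard condition is
  this sum times the nonvanishing product of the three functions.\<close>

lemma coefficient_sum:
  assumes ne: "i \<noteq> j" "j \<noteq> k" "i \<noteq> k"
  shows "eps i * c i + eps j * c j + eps k * c k = 0"
proof -
  obtain t where t: "t \<in> I"
    using I_nonempty by auto
  have "d i t = c i * l k t * l j t" "d j t = c j * l k t * l i t" "d k t = c k * l j t * l i t"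
    using c[of i j k t] c[of j i k t] c[of k i j t] ne t by auto
  then have "(l i t * l j t * l k t) * (eps i * c i + eps j * c j + eps k * c k) = 0"
    using guichard_deriv[OF t ne] by algebra
  then show ?thesis using l_nonzero[OF t] by simp
qed

lemma second_derivative:
  assumes ne: "i \<noteq> j" "j \<noteq> k" "i \<noteq> k" and t: "t \<in> I"
  shows "e i t = c i * (d k t * l j t + l k t * d j t)"
proof -
  have "((\<lambda>t. c i * l k t * l j t) has_real_derivative c i * (d k t * l j t + l k t * d j t)) (at t)"
    by (auto intro!: derivative_eq_intros l_deriv t simp: algebra_simps)
  moreover have "((\<lambda>t. c i * l k t * l j t) has_real_derivative e i t) (at t)"
    by (rule has_field_derivative_transform_within_open[OF d_deriv[OF t] open_I t])
      (rule c[OF ne])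
  ultimately show ?thesis
    using DERIV_unique by blast
qed

text \<open>Since \<open>d i / l j\<close> equals \<open>c i * l k\<close>, its derivative is
  \<open>c i * c k * l i * l j\<close>. Every term of \<open>gauss\<close> thus carries the factor
  \<open>l i * l j\<close>, which is cancelled at a single point.\<close>

lemma coefficient_quadratic:
  assumes ne: "i \<noteq> j" "j \<noteq> k" "i \<noteq> k"
  shows "(a i)\<^sup>2 * c j * c k + (a j)\<^sup>2 * c i * c k + (a k)\<^sup>2 * c i * c j = 0"
proof -
  obtain t where t: "t \<in> I"
    using I_nonempty by auto
  note lz = l_nonzero[OF t]
  have d: "d i t = c i * l k t * l j t" "d j t = c j * l k t * l i t" "d k t = c k * l j t * l i t"
    using c[of i j k t] c[of j i k t] c[of k i j t] ne t by auto
  have q1: "(e i t * l j t - d i t * d j t) / (l j t)\<^sup>2 = c i * c k * (l i t * l j t)"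
    using lz[of j] unfolding second_derivative[OF ne t] d
    by (simp add: field_simps power2_eq_square)
  have "e j t = c j * (d k t * l i t + l k t * d i t)"
    using second_derivative[of j i k t] ne t by auto
  then have q2: "(e j t * l i t - d j t * d i t) / (l i t)\<^sup>2 = c j * c k * (l i t * l j t)"
    using lz[of i] unfolding d by (simp add: field_simps power2_eq_square)
  have q3: "d i t * d j t / (l k t)\<^sup>2 = c i * c j * (l i t * l j t)"
    using lz[of k] unfolding d by (simp add: field_simps power2_eq_square)
  have "(l i t * l j t) * ((a i)\<^sup>2 * c j * c k + (a j)\<^sup>2 * c i * c k + (a k)\<^sup>2 * c i * c j) = 0"
    using gauss[OF t ne] unfolding q1 q2 q3 by algebra
  then show ?thesis using lz by simp
qed

text \<open>Both squares contribute the same derivative, \<open>2 * c i * c j\<close> times the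
  product of all three functions.\<close>

lemma first_integral:
  assumes ne: "i \<noteq> j" "j \<noteq> k" "i \<noteq> k"
  obtains lam where "\<And>t. t \<in> I \<Longrightarrow> c j * (l i t)\<^sup>2 - c i * (l j t)\<^sup>2 = lam"
proof -
  have "((\<lambda>t. c j * (l i t)\<^sup>2 - c i * (l j t)\<^sup>2) has_real_derivative 0) (at t)" if t: "t \<in> I" for t
  proof -
    have "d i t = c i * l k t * l j t" "d j t = c j * l k t * l i t"
      using c[of i j k t] c[of j i k t] ne t by auto
    then show ?thesis
      by (auto intro!: derivative_eq_intros l_deriv t simp: algebra_simps)
  qed
  then show thesis
    using eq_const_if_deriv_zero that by blast
qed

end

end

section \<open>From partial derivatives to derivatives in \<open>\<xi>\<close>\<close>

text \<open>The chain rule on a coordinate line, where \<open>\<alpha> \<bullet> y\<close> is affine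
  with slope \<open>\<alpha> $ j\<close>. Agreement of \<open>f\<close> and \<open>g\<close> over
  \<open>I\<close> suffices because the preimage of \<open>I\<close> on that line is open.\<close>

lemma partial_along_inner:
  assumes "open I" "\<alpha> \<bullet> x \<in> I" "(g has_real_derivative D) (at (\<alpha> \<bullet> x))"
    and "\<And>y. \<alpha> \<bullet> y \<in> I \<Longrightarrow> f y = g (\<alpha> \<bullet> y)"
  shows "partial j f x = \<alpha> $ j * D"
proof -
  let ?p = "\<lambda>t. \<alpha> \<bullet> (x + t *\<^sub>R axis j 1)"
  have p: "?p t = \<alpha> \<bullet> x + t * \<alpha> $ j" for t
    by (simp add: inner_add_right inner_axis)
  have "(?p has_real_derivative \<alpha> $ j) (at 0)"
    unfolding p by (auto intro!: derivative_eq_intros)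
  then have "((\<lambda>t. g (?p t)) has_real_derivative D * \<alpha> $ j) (at 0)"
    by (intro DERIV_chain2[where f=g]) (use assms(3) p in auto)
  moreover have "open (?p -` I)"
    by (intro open_vimage assms continuous_intros)
  ultimately have "((\<lambda>t. f (x + t *\<^sub>R axis j 1)) has_real_derivative D * \<alpha> $ j) (at 0)"
    by (rule has_field_derivative_transform_within_open) (use assms(2,4) in auto)
  then show ?thesis
    unfolding partial_def by (simp add: DERIV_imp_deriv mult.commute)
qed

theorem theorem3:
  fixes \<alpha> :: "real ^ 3" and I :: "real set" and l :: "3 \<Rightarrow> real \<Rightarrow> real"
  assumes "\<alpha> \<noteq> 0"
    and "open I" "is_interval I" "I \<noteq> {}"
    and "\<And>s. smooth_real_on I (l s)"
    and "\<And>s t. t \<in> I \<Longrightarrow> l s t \<noteq> 0"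
    and "lame_guichard {x. (\<Sum>s\<in>UNIV. \<alpha> $ s * x $ s) \<in> I}
           (\<lambda>i x. l i (\<Sum>s\<in>UNIV. \<alpha> $ s * x $ s))"
    and "\<And>s. \<not> l s constant_on I"
  shows "\<exists>c :: 3 \<Rightarrow> real.
    (\<forall>i. c i \<noteq> 0) \<and>
    (\<forall>i j k. i \<noteq> j \<and> j \<noteq> k \<and> i \<noteq> k \<longrightarrow> (\<forall>t\<in>I. deriv (l i) t = c i * l k t * l j t)) \<and>
    c 1 - c 2 + c 3 = 0 \<and>
    (\<alpha> $ 1)\<^sup>2 * c 2 * c 3 + (\<alpha> $ 2)\<^sup>2 * c 1 * c 3 + (\<alpha> $ 3)\<^sup>2 * c 1 * c 2 = 0 \<and>
    (\<exists>lam :: real. \<forall>t\<in>I.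
       (deriv (l 1) t)\<^sup>2 =
         c 2 * (c 2 - c 1) * ((l 1 t)\<^sup>2 - lam / c 2) * ((l 1 t)\<^sup>2 - lam / (c 2 - c 1)) \<and>
       (l 2 t)\<^sup>2 = c 2 / c 1 * ((l 1 t)\<^sup>2 - lam / c 2) \<and>
       (l 3 t)\<^sup>2 = (c 2 - c 1) / c 1 * ((l 1 t)\<^sup>2 - lam / (c 2 - c 1)))"
proof -
  define d where "d i = deriv (l i)" for i
  define e where "e i = deriv (d i)" for i
  define L where "L i x = l i (\<alpha> \<bullet> x)" for i x
  have sum_inner: "(\<Sum>s\<in>UNIV. \<alpha> $ s * x $ s) = \<alpha> \<bullet> x" for x :: "real ^ 3"
    by (simp add: inner_vec_def)
  have lame: "lame_guichard {x. \<alpha> \<bullet> x \<in> I} L"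
    using assms(7) unfolding sum_inner L_def .
  have smooth: "((deriv ^^ n) (l i) has_real_derivative deriv ((deriv ^^ n) (l i)) t) (at t)"
    if "t \<in> I" for n i t
    using assms(2,5) that
    by (metis DERIV_deriv_iff_real_differentiable at_within_open differentiable_on_def
        smooth_real_on_def)
  have l_deriv: "(l i has_real_derivative d i t) (at t)" if "t \<in> I" for i t
    using smooth[OF that, of 0 i] by (simp add: d_def)
  have d_deriv: "(d i has_real_derivative e i t) (at t)" if "t \<in> I" for i t
    using smooth[OF that, of 1 i] by (simp add: d_def e_def)
  have partial_L: "partial j (L i) x = \<alpha> $ j * d i (\<alpha> \<bullet> x)" if "\<alpha> \<bullet> x \<in> I" for i j x
    by (rule partial_along_inner[OF assms(2) that l_deriv[OF that]]) (simp add: L_def)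
  have h: "rot_coeff L i j x = \<alpha> $ j * (d i (\<alpha> \<bullet> x) / l j (\<alpha> \<bullet> x))" if "\<alpha> \<bullet> x \<in> I" for i j x
    unfolding rot_coeff_def partial_L[OF that] by (simp add: L_def)
  have partial_h: "partial k (rot_coeff L i j) x = \<alpha> $ k * (\<alpha> $ j *
      ((e i (\<alpha> \<bullet> x) * l j (\<alpha> \<bullet> x) - d i (\<alpha> \<bullet> x) * d j (\<alpha> \<bullet> x)) / (l j (\<alpha> \<bullet> x))\<^sup>2))"
    if x: "\<alpha> \<bullet> x \<in> I" for i j k x
  proof (rule partial_along_inner[OF assms(2) x, where g="\<lambda>t. \<alpha> $ j * (d i t / l j t)"])
    show "((\<lambda>t. \<alpha> $ j * (d i t / l j t)) has_real_derivative \<alpha> $ j *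
      ((e i (\<alpha> \<bullet> x) * l j (\<alpha> \<bullet> x) - d i (\<alpha> \<bullet> x) * d j (\<alpha> \<bullet> x)) / (l j (\<alpha> \<bullet> x))\<^sup>2)) (at (\<alpha> \<bullet> x))"
      using assms(6)[OF x]
      by (auto intro!: derivative_eq_intros l_deriv d_deriv x simp: power2_eq_square algebra_simps)
  qed (rule h)
  \<comment> \<open>Every parameter in \<open>I\<close> is attained at some point, so the equations
    on the slab yield equations on all of \<open>I\<close>.\<close>
  have surj: "\<exists>x. \<alpha> \<bullet> x = t" for t
    using assms(1) by (intro exI[of _ "(t / (\<alpha> \<bullet> \<alpha>)) *\<^sub>R \<alpha>"]) simp
  have convex: "convex I"
    using assms(3) by (simp add: is_interval_convex)
  interpret lame_ode "\<lambda>i. \<alpha> $ i" I l d e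
  proof
    show "\<exists>i. \<alpha> $ i \<noteq> 0"
      using assms(1) by (metis vec_eq_iff zero_index)
    show "\<exists>t\<in>I. d i t \<noteq> 0" for i
    proof (rule ccontr)
      assume "\<not> ?thesis"
      then have "(l i has_real_derivative 0) (at t within I)" if "t \<in> I" for t
        using l_deriv[OF that, of i] that by (auto intro: has_field_derivative_at_within)
      then show False
        using has_field_derivative_zero_constant[OF convex, of "l i"] assms(8)
        by (auto simp: constant_on_def)
    qed
    fix t i j k
    assume t: "t \<in> I" and ne: "i \<noteq> j" "j \<noteq> k" "i \<noteq> (k::3)"
    obtain x where x: "\<alpha> \<bullet> x = t" using surj by blast
    have x': "\<alpha> \<bullet> x \<in> I" using x t by simp
    have sys: "eps i * (L i x)\<^sup>2 + eps j * (L j x)\<^sup>2 + eps k * (L k x)\<^sup>2 = 0"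
      "partial k (rot_coeff L i j) x - rot_coeff L i k x * rot_coeff L k j x = 0"
      "partial j (rot_coeff L i j) x + partial i (rot_coeff L j i) x
        + rot_coeff L i k x * rot_coeff L j k x = 0"
      using lame x' ne unfolding lame_guichard_def Let_def by blast+
    show "eps i * (l i t)\<^sup>2 + eps j * (l j t)\<^sup>2 + eps k * (l k t)\<^sup>2 = 0"
      using sys(1) by (simp add: L_def x)
    show "\<alpha> $ k * \<alpha> $ j * ((e i t * l j t - d i t * d j t) / (l j t)\<^sup>2)
        = \<alpha> $ k * \<alpha> $ j * (d i t * d k t / (l k t * l j t))"
      using sys(2) unfolding partial_h[OF x'] h[OF x'] unfolding x by (simp add: mult_ac)
    show "(\<alpha> $ j)\<^sup>2 * ((e i t * l j t - d i t * d j t) / (l j t)\<^sup>2)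
        + (\<alpha> $ i)\<^sup>2 * ((e j t * l i t - d j t * d i t) / (l i t)\<^sup>2)
        + (\<alpha> $ k)\<^sup>2 * (d i t * d j t / (l k t)\<^sup>2) = 0"
      using sys(3) unfolding partial_h[OF x'] h[OF x'] unfolding x
      by (simp add: mult_ac power2_eq_square)
  qed (use assms convex l_deriv d_deriv in auto)
  have ne: "(1::3) \<noteq> 2" "(2::3) \<noteq> 3" "(1::3) \<noteq> 3" by auto
  obtain c where c: "\<And>i j k t. \<lbrakk>i \<noteq> j; j \<noteq> k; i \<noteq> k; t \<in> I\<rbrakk> \<Longrightarrow> d i t = c i * l k t * l j t"
    using first_order_coefficients by blast
  have c0: "c i \<noteq> 0" for i
    using coefficient_nonzero[OF c] .
  have c_sum: "c 1 - c 2 + c 3 = 0"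
    using coefficient_sum[OF c ne] by (simp add: eps_def)
  then have c3: "c 3 = c 2 - c 1" by simp
  then have c21: "c 2 - c 1 \<noteq> 0" using c0[of 3] by simp
  obtain lam where lam: "\<And>t. t \<in> I \<Longrightarrow> c 2 * (l 1 t)\<^sup>2 - c 1 * (l 2 t)\<^sup>2 = lam"
    using first_integral[OF c ne] by blast
  have "(d 1 t)\<^sup>2 =
         c 2 * (c 2 - c 1) * ((l 1 t)\<^sup>2 - lam / c 2) * ((l 1 t)\<^sup>2 - lam / (c 2 - c 1)) \<and>
       (l 2 t)\<^sup>2 = c 2 / c 1 * ((l 1 t)\<^sup>2 - lam / c 2) \<and>
       (l 3 t)\<^sup>2 = (c 2 - c 1) / c 1 * ((l 1 t)\<^sup>2 - lam / (c 2 - c 1))"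
    if t: "t \<in> I" for t
  proof -
    \<comment> \<open>\<open>A\<close> and \<open>B\<close> are the formulas for the squares of
      \<open>l 2\<close> and \<open>l 3\<close>, multiplied by \<open>c 1\<close>. Their product is
      the square of \<open>c 1 * l 2 t * l 3 t\<close>, that is, of \<open>d 1 t\<close>.\<close>
    have A: "c 2 * ((l 1 t)\<^sup>2 - lam / c 2) = c 1 * (l 2 t)\<^sup>2"
      using lam[OF t] c0[of 2] by (simp add: right_diff_distrib)
    have "(c 2 - c 1) * ((l 1 t)\<^sup>2 - lam / (c 2 - c 1)) = (c 2 - c 1) * (l 1 t)\<^sup>2 - lam"
      using c21 by (simp add: right_diff_distrib)
    also have "\<dots> = c 1 * (l 3 t)\<^sup>2"
    proof -
      have "(l 3 t)\<^sup>2 = (l 2 t)\<^sup>2 - (l 1 t)\<^sup>2"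
        using guichard[OF t ne] by (simp add: eps_def)
      then show ?thesis
        using lam[OF t] by algebra
    qed
    finally have B: "(c 2 - c 1) * ((l 1 t)\<^sup>2 - lam / (c 2 - c 1)) = c 1 * (l 3 t)\<^sup>2" .
    have "(d 1 t)\<^sup>2 = (c 1 * (l 2 t)\<^sup>2) * (c 1 * (l 3 t)\<^sup>2)"
      using c[OF ne t] by (simp add: power2_eq_square mult_ac)
    then have "(d 1 t)\<^sup>2 =
        c 2 * (c 2 - c 1) * ((l 1 t)\<^sup>2 - lam / c 2) * ((l 1 t)\<^sup>2 - lam / (c 2 - c 1))"
      unfolding A[symmetric] B[symmetric] by (simp only: mult_ac)
    then show ?thesis
      using A B c0[of 1] by simp
  qed
  then show ?thesis
    using c0 c c_sum coefficient_quadratic[OF c ne] unfolding d_def by blast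
qed

end
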